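(* Let $\Delta,M,t,m$ be positive integers. Let $G$ be a bipartite graph with bipartition $(V_0,V_1)$ and let $X=\{x_1,\dots,x_t\}$ be a set of $t$ distinct vertices of $V_0\cup V_1$. Let $T_{x_1},\dots,T_{x_t}$ be rooted trees with $\sum_{i=1}^t|T_{x_i}|\leq M$ and $\Delta(T_{x_i})\leq\Delta$ for all $i\in\{1,\dots,t\}$. Suppose that: \begin{enumerate} \item for every $i\in\{0,1\}$ and every $S\subseteq V_i$ with $|S|\leq m$, $$|N_G(S)\setminus X|\geq 2\Delta|S\setminus X|+\sum_{x\in S\cap X}\big(d_{root}(T_x)+\Delta\big);$$ \item for every $i\in\{0,1\}$ and every $S\subseteq V_i$ with $m\leq|S|\leq 2m$, $|N_G(S)|\geq M+8\Delta m$. \end{enumerate} Then $G$ contains pairwise vertex-disjoint copies of $T_{x_1},\dots,T_{x_t}$ such that for each $i$ the root of $T_{x_i}$ is mapped to $x_i$.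
   Context: $|T|$ is the number of vertices of a tree $T$ and $\Delta(T)$ its maximum degree. For a rooted tree $T$, $d_{root}(T)$ denotes the degree in $T$ of its root. For $S\subseteq V(G)$, $N_G(S)=\bigcup_{x\in S}N_G(x)$ is the union of the neighbourhoods of the vertices of $S$. *)

theory Defs
  imports "Graph_Theory.Pair_Digraph" "Graph_Theory.Digraph_Component"
begin

text \<open>
  A finite simple graph is a \<^locale>\<open>pair_graph\<close>: a finite, loopless, symmetric set of arcs,
  where the edge $uv$ is represented by the two arcs $(u,v)$ and $(v,u)$.
  Hence the degree of a vertex is its \<^const>\<open>out_degree\<close>.
\<close>

definition bipartition :: "'a pair_pre_digraph \<Rightarrow> 'a set \<Rightarrow> 'a set \<Rightarrow> bool" where
  "bipartition G A B \<longleftrightarrow> A \<union> B = pverts G \<and> A \<inter> B = {} \<and> parcs G \<subseteq> A \<times> B \<union> B \<times> A"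

definition nbhd :: "'a pair_pre_digraph \<Rightarrow> 'a set \<Rightarrow> 'a set" where
  "nbhd G S = (\<Union>u\<in>S. {v. (u, v) \<in> parcs G})"

definition max_degree :: "'a pair_pre_digraph \<Rightarrow> nat" where
  "max_degree G = Max (out_degree (with_proj G) ` pverts G)"

text \<open>
  The library predicate \<^const>\<open>tree\<close> is not usable for symmetric digraphs: there, each edge
  traversed back and forth is a \<^const>\<open>pre_digraph.cycle\<close> of length two. The cycles
  of a simple graph are exactly those of length at least three.
\<close>

definition graph_tree :: "'a pair_pre_digraph \<Rightarrow> bool" where
  "graph_tree T \<longleftrightarrow> pair_graph T \<and> connected (with_proj T) \<and>
     \<not> (\<exists>p. pre_digraph.cycle (with_proj T) p \<and> 3 \<le> length p)"

definition rooted_tree :: "'a pair_pre_digraph \<Rightarrow> 'a \<Rightarrow> bool" where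
  "rooted_tree T r \<longleftrightarrow> graph_tree T \<and> r \<in> pverts T"

text \<open>Embeddings as a not necessarily induced subgraph: the image is a copy of \<open>H\<close> in \<open>G\<close>.\<close>

definition graph_embedding :: "('b \<Rightarrow> 'a) \<Rightarrow> 'b pair_pre_digraph \<Rightarrow> 'a pair_pre_digraph \<Rightarrow> bool" where
  "graph_embedding f H G \<longleftrightarrow> inj_on f (pverts H) \<and> f ` pverts H \<subseteq> pverts G \<and>
     (\<forall>u v. (u, v) \<in> parcs H \<longrightarrow> (f u, f v) \<in> parcs G)"

end

theory Submission
  imports Defs
begin

text \<open>
  The forest is embedded one vertex at a time (the method of Friedman, Pippenger and Haxell).
  Let \<open>X\<close> be the set of vertices of \<open>G\<close> used so far. Give a used vertex the demand
  \<open>\<Delta> + (number of its children still to be embedded)\<close> and an unused one the demand \<open>2\<Delta>\<close>. The invariant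
  is that every set \<open>S\<close> of at most \<open>m\<close> vertices on one side has at least as many unused neighbours
  as its total demand; call \<open>S\<close> tight if equality holds. By submodularity of
  \<open>|N(S) - X|\<close> a union of tight sets is tight as long as the invariant holds for it, and since sets of
  size between \<open>m\<close> and \<open>2m\<close> expand strictly, tight sets stay smaller than \<open>m\<close>. Embedding a child of
  \<open>v\<close> at \<open>y\<close> can break the invariant only at a tight set that sees \<open>y\<close> and avoids \<open>v\<close>.
\<close>

section \<open>Neighbourhoods and tight sets\<close>

lemma nbhd_Un: "nbhd G (S \<union> S') = nbhd G S \<union> nbhd G S'"
  by (auto simp: nbhd_def)

lemma nbhd_Int_subset: "nbhd G (S \<inter> S') \<subseteq> nbhd G S \<inter> nbhd G S'"
  by (auto simp: nbhd_def)

lemma finite_nbhd: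
  assumes "pair_graph G"
  shows "finite (nbhd G S)"
proof -
  interpret pair_graph G by fact
  have "nbhd G S \<subseteq> pverts G"
    by (auto simp: nbhd_def dest: in_arcsD2)
  then show ?thesis using pair_finite_verts finite_subset by blast
qed

text \<open>The surplus \<open>card (nbhd G S - X) - sum c S\<close> is submodular, since
  \<open>sum c\<close> is modular. It vanishes at \<open>A\<close> and \<open>B\<close> and is
  nonnegative at their union and intersection, so it vanishes there too.\<close>

lemma tight_Un:
  fixes c :: "'a \<Rightarrow> nat"
  assumes G: "pair_graph G" and fin: "finite A" "finite B"
    and A: "sum c A = card (nbhd G A - X)" and B: "sum c B = card (nbhd G B - X)"
    and Int: "sum c (A \<inter> B) \<le> card (nbhd G (A \<inter> B) - X)"
    and Un: "sum c (A \<union> B) \<le> card (nbhd G (A \<union> B) - X)"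
  shows "sum c (A \<union> B) = card (nbhd G (A \<union> B) - X)"
proof -
  let ?N = "\<lambda>S. nbhd G S - X"
  have fN: "finite (?N S)" for S using finite_nbhd[OF G] by blast
  have "card (?N (A \<inter> B)) \<le> card (?N A \<inter> ?N B)"
    using nbhd_Int_subset[of G A B] fN by (intro card_mono) blast+
  moreover have "?N (A \<union> B) = ?N A \<union> ?N B" by (auto simp: nbhd_Un)
  moreover have "card (?N A) + card (?N B) = card (?N A \<union> ?N B) + card (?N A \<inter> ?N B)"
    by (rule card_Un_Int[OF fN fN])
  moreover have "sum c A + sum c B = sum c (A \<union> B) + sum c (A \<inter> B)"
    using fin by (simp add: sum.union_inter)
  ultimately show ?thesis using A B Int Un by simp
qed

text \<open>
  If every candidate \<open>y\<close> lay in the neighbourhood of a tight set avoiding \<open>v\<close>, the union \<open>S\<close> of these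
  sets would be a tight set whose neighbourhood already covers that of \<open>v\<close>, so that
  \<open>insert v S\<close> violates the expansion hypothesis.
\<close>
lemma exists_slack_neighbour:
  fixes c :: "'a \<Rightarrow> nat"
  assumes G: "pair_graph G" and U: "finite U" and m: "m > 0"
    and small: "\<And>S. S \<subseteq> U \<Longrightarrow> card S \<le> m \<Longrightarrow> sum c S \<le> card (nbhd G S - X)"
    and large: "\<And>S. S \<subseteq> U \<Longrightarrow> m \<le> card S \<Longrightarrow> card S \<le> 2 * m \<Longrightarrow> sum c S < card (nbhd G S - X)"
    and v: "v \<in> U" "c v > 0"
  shows "\<exists>y\<in>nbhd G {v} - X. \<forall>S. S \<subseteq> U \<longrightarrow> card S \<le> m \<longrightarrow> v \<notin> S \<longrightarrow> y \<in> nbhd G S \<longrightarrow>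
           sum c S < card (nbhd G S - X)"
proof (rule ccontr)
  \<comment> \<open>Demanding \<open>card S < m\<close> loses nothing, because \<open>large\<close>
    excludes equality at size \<open>m\<close>. It leaves room for inserting \<open>v\<close> at the
    end without exceeding \<open>m\<close>.\<close>
  define tight where "tight S \<longleftrightarrow> S \<subseteq> U \<and> card S < m \<and> v \<notin> S \<and> sum c S = card (nbhd G S - X)" for S
  have finU: "finite S" if "S \<subseteq> U" for S using that U finite_subset by blast
  have tightUn: "tight (A \<union> B)" if "tight A" "tight B" for A B
  proof -
    have sub: "A \<subseteq> U" "B \<subseteq> U" and cd: "card A < m" "card B < m" using that by (auto simp: tight_def)
    have cU: "card (A \<union> B) \<le> 2 * m" using card_Un_le[of A B] cd by simp
    have cI: "card (A \<inter> B) \<le> m"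
      using card_mono[of A "A \<inter> B"] finU[OF sub(1)] cd by simp
    have "sum c (A \<union> B) \<le> card (nbhd G (A \<union> B) - X)"
      using small[of "A \<union> B"] large[of "A \<union> B"] sub cU by (cases "card (A \<union> B) \<le> m") auto
    moreover have "sum c (A \<inter> B) \<le> card (nbhd G (A \<inter> B) - X)"
      using small[of "A \<inter> B"] sub cI by blast
    ultimately have eq: "sum c (A \<union> B) = card (nbhd G (A \<union> B) - X)"
      using tight_Un[OF G finU[OF sub(1)] finU[OF sub(2)]] that by (simp add: tight_def)
    \<comment> \<open>The union has at most 2m elements, and between m and 2m the strict bound
      \<open>large\<close> contradicts equality.\<close>
    then have "card (A \<union> B) < m" using large[of "A \<union> B"] sub cU by fastforce
    then show ?thesis using eq sub that by (simp add: tight_def)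
  qed
  assume contra: "\<not> ?thesis"
  have ex: "\<exists>S. tight S \<and> y \<in> nbhd G S" if y: "y \<in> nbhd G {v} - X" for y
  proof -
    obtain S where S: "S \<subseteq> U" "card S \<le> m" "v \<notin> S" "y \<in> nbhd G S" "\<not> sum c S < card (nbhd G S - X)"
      using contra y by blast
    then have "sum c S = card (nbhd G S - X)" using small[of S] by simp
    moreover have "card S < m" using S large[of S] by (cases "card S = m") auto
    ultimately show ?thesis using S by (auto simp: tight_def)
  qed
  have "finite (nbhd G {v} - X)" using finite_nbhd[OF G] by blast
  moreover have "\<exists>S. tight S \<and> F \<subseteq> nbhd G S" if "finite F" "F \<subseteq> nbhd G {v} - X" for F
    using that
  proof (induction F rule: finite_induct)
    case empty
    have "tight {}" using m by (auto simp: tight_def nbhd_def)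
    then show ?case by blast
  next
    case (insert y F)
    then obtain S where S: "tight S" "F \<subseteq> nbhd G S" by blast
    obtain S' where S': "tight S'" "y \<in> nbhd G S'" using ex[of y] insert.prems by blast
    show ?case using tightUn[OF S(1) S'(1)] S S' by (intro exI[of _ "S \<union> S'"]) (auto simp: nbhd_Un)
  qed
  ultimately obtain S where S: "tight S" "nbhd G {v} - X \<subseteq> nbhd G S" by blast
  have fS: "finite S" using S(1) finU by (auto simp: tight_def)
  have "nbhd G (insert v S) - X = nbhd G S - X"
    using S(2) by (auto simp: nbhd_def)
  moreover have "sum c (insert v S) = c v + sum c S" using fS S(1) by (simp add: tight_def)
  moreover have "sum c (insert v S) \<le> card (nbhd G (insert v S) - X)"
    using S(1) v fS by (intro small) (auto simp: tight_def)
  ultimately show False using S(1) v by (simp add: tight_def)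
qed

section \<open>Growing a forest from its roots, and the demands\<close>

text \<open>\<open>R\<close> is the set of roots, and each new vertex hangs on exactly one vertex
  already present. This uniqueness means that embedding it creates only one edge to realise.\<close>

inductive grown :: "('c \<times> 'c) set \<Rightarrow> 'c set \<Rightarrow> 'c set \<Rightarrow> bool"
  for A :: "('c \<times> 'c) set" and R :: "'c set" where
  base: "grown A R R"
| step: "grown A R D \<Longrightarrow> w \<notin> D \<Longrightarrow> {v \<in> D. (v, w) \<in> A} = {u} \<Longrightarrow> grown A R (insert w D)"

lemma grown_superset: "grown A R D \<Longrightarrow> R \<subseteq> D"
  by (induction rule: grown.induct) auto

lemma grown_subset: "grown A R D \<Longrightarrow> R \<subseteq> W \<Longrightarrow> A \<subseteq> W \<times> W \<Longrightarrow> D \<subseteq> W"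
  by (induction rule: grown.induct) blast+

text \<open>Demands live on vertices of the host graph, so the forest vertex behind \<open>v\<close>
  is recovered by \<open>inv_into\<close>, which is faithful when \<open>f\<close> is injective on
  \<open>D\<close>. Its neighbours outside \<open>D\<close> are the children still to be
  embedded.\<close>

definition demand :: "('c \<times> 'c) set \<Rightarrow> nat \<Rightarrow> 'c set \<Rightarrow> ('c \<Rightarrow> 'a) \<Rightarrow> 'a \<Rightarrow> nat" where
  "demand A \<Delta> D f v =
     (if v \<in> f ` D then card {w. (inv_into D f v, w) \<in> A \<and> w \<notin> D} + \<Delta> else 2 * \<Delta>)"

lemma demand_image:
  "inj_on f D \<Longrightarrow> d \<in> D \<Longrightarrow> demand A \<Delta> D f (f d) = card {w. (d, w) \<in> A \<and> w \<notin> D} + \<Delta>"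
  by (auto simp: demand_def)

lemma demand_not_image: "v \<notin> f ` D \<Longrightarrow> demand A \<Delta> D f v = 2 * \<Delta>"
  by (auto simp: demand_def)

lemma demand_le:
  assumes "finite A" and deg: "\<And>u. card {w. (u, w) \<in> A} \<le> \<Delta>"
  shows "demand A \<Delta> D f v \<le> 2 * \<Delta>"
proof -
  have "card {w. (u, w) \<in> A \<and> w \<notin> D} \<le> \<Delta>" for u
  proof -
    have "finite {w. (u, w) \<in> A}"
      using finite_subset[of "{w. (u, w) \<in> A}" "snd ` A"] \<open>finite A\<close> by force
    then have "card {w. (u, w) \<in> A \<and> w \<notin> D} \<le> card {w. (u, w) \<in> A}"
      by (intro card_mono) auto
    then show ?thesis using deg[of u] by simp
  qed
  then show ?thesis by (simp add: demand_def add.commute mult_2)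
qed

lemma demand_extend:
  assumes "finite A" and deg: "\<And>u. card {w. (u, w) \<in> A} \<le> \<Delta>"
    and inj: "inj_on f D" and w: "w \<notin> D" and u: "{v \<in> D. (v, w) \<in> A} = {u}"
    and y: "y \<notin> f ` D"
  shows "demand A \<Delta> (insert w D) (f(w := y)) z + (if z = f u then 1 else 0) \<le> demand A \<Delta> D f z"
proof -
  let ?f = "f(w := y)" and ?D = "insert w D"
  have fin: "finite {w. (v, w) \<in> A}" for v
    using finite_subset[of "{w. (v, w) \<in> A}" "snd ` A"] \<open>finite A\<close> by force
  have inj': "inj_on ?f ?D" using inj w y by (auto simp: inj_on_def)
  have uD: "u \<in> D" "(u, w) \<in> A" using u by auto
  consider "z = y" | d where "d \<in> D" "z = f d" | "z \<noteq> y" "z \<notin> f ` D" by blast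
  then show ?thesis
  proof cases
    case 1
    have "{v. (w, v) \<in> A \<and> v \<notin> ?D} \<subseteq> {v. (w, v) \<in> A}" by auto
    then have "card {v. (w, v) \<in> A \<and> v \<notin> ?D} \<le> \<Delta>" using card_mono[OF fin] deg[of w] order_trans by blast
    moreover have "demand A \<Delta> ?D ?f y = card {v. (w, v) \<in> A \<and> v \<notin> ?D} + \<Delta>"
      using demand_image[OF inj', of w] by simp
    moreover have "z \<noteq> f u" using 1 y uD by auto
    ultimately show ?thesis using 1 demand_not_image[OF y, of A \<Delta>] by simp
  next
    case 2
    have "?f d = f d" using 2 w by auto
    then have new: "demand A \<Delta> ?D ?f z = card {v. (d, v) \<in> A \<and> v \<notin> ?D} + \<Delta>"
      using demand_image[OF inj', of d A \<Delta>] 2 by simp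
    have old: "demand A \<Delta> D f z = card {v. (d, v) \<in> A \<and> v \<notin> D} + \<Delta>"
      using demand_image[OF inj] 2 by simp
    have finD: "finite {v. (d, v) \<in> A \<and> v \<notin> D}" using fin[of d] by (rule rev_finite_subset) auto
    show ?thesis
    proof (cases "d = u")
      case True
      then have "{v. (d, v) \<in> A \<and> v \<notin> D} = insert w {v. (d, v) \<in> A \<and> v \<notin> ?D}"
        using uD w by auto
      then have "card {v. (d, v) \<in> A \<and> v \<notin> D} = Suc (card {v. (d, v) \<in> A \<and> v \<notin> ?D})"
        using finD by simp
      then show ?thesis using new old by simp
    next
      case False
      have "card {v. (d, v) \<in> A \<and> v \<notin> ?D} \<le> card {v. (d, v) \<in> A \<and> v \<notin> D}"
        using finD by (intro card_mono) auto
      moreover have "z \<noteq> f u" using False 2 uD inj by (auto simp: inj_on_def)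
      ultimately show ?thesis using new old by simp
    qed
  next
    case 3
    then have "z \<notin> ?f ` ?D" using w by (auto split: if_splits)
    then show ?thesis using 3 uD by (auto simp: demand_not_image)
  qed
qed

section \<open>Embedding a grown forest\<close>

text \<open>Induction along \<open>grown\<close>. The expansion invariant is part of the conclusion
  because it is what allows the next vertex to be placed.\<close>

lemma grown_embeds:
  fixes V :: "nat \<Rightarrow> 'a set" and A :: "('c \<times> 'c) set"
  assumes G: "pair_graph G" and bip: "bipartition G (V 0) (V 1)"
    and "m > 0" and "\<Delta> > 0"
    and W: "finite W" "A \<subseteq> W \<times> W" "card W \<le> M" and "R \<subseteq> W"
    and sym: "sym A" and irr: "irrefl A" and deg: "\<And>u. card {w. (u, w) \<in> A} \<le> \<Delta>"
    and R: "inj_on f0 R" "f0 ` R \<subseteq> pverts G" "A \<inter> R \<times> R = {}"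
    and small: "\<And>i S. i \<in> {0, 1} \<Longrightarrow> S \<subseteq> V i \<Longrightarrow> card S \<le> m \<Longrightarrow>
          sum (demand A \<Delta> R f0) S \<le> card (nbhd G S - f0 ` R)"
    and large: "\<And>i S. i \<in> {0, 1} \<Longrightarrow> S \<subseteq> V i \<Longrightarrow> m \<le> card S \<Longrightarrow> card S \<le> 2 * m \<Longrightarrow>
          M + 8 * \<Delta> * m \<le> card (nbhd G S)"
    and "grown A R D"
  shows "\<exists>f. (\<forall>v\<in>R. f v = f0 v) \<and> inj_on f D \<and> f ` D \<subseteq> pverts G \<and>
           (\<forall>u v. u \<in> D \<longrightarrow> v \<in> D \<longrightarrow> (u, v) \<in> A \<longrightarrow> (f u, f v) \<in> parcs G) \<and>
           (\<forall>i\<in>{0, 1}. \<forall>S. S \<subseteq> V i \<longrightarrow> card S \<le> m \<longrightarrow>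
              sum (demand A \<Delta> D f) S \<le> card (nbhd G S - f ` D))"
  using \<open>grown A R D\<close>
proof (induction rule: grown.induct)
  case base
  \<comment> \<open>No arc joins two roots, so the arc condition is vacuous at the start.\<close>
  show ?case using R small by (intro exI[of _ f0]) auto
next
  case (step D w u)
  interpret pair_graph G by fact
  have symG: "(b, a) \<in> parcs G" if "(a, b) \<in> parcs G" for a b
    using symD[OF pair_sym_arcs[unfolded symmetric_def]] that by simp
  have finA: "finite A" using W finite_subset by blast
  obtain f where f: "\<forall>v\<in>R. f v = f0 v" "inj_on f D" "f ` D \<subseteq> pverts G"
    "\<forall>u v. u \<in> D \<longrightarrow> v \<in> D \<longrightarrow> (u, v) \<in> A \<longrightarrow> (f u, f v) \<in> parcs G"
    and all: "\<forall>i\<in>{0, 1}. \<forall>S. S \<subseteq> V i \<longrightarrow> card S \<le> m \<longrightarrow>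
              sum (demand A \<Delta> D f) S \<le> card (nbhd G S - f ` D)"
    using step.IH by (elim exE conjE)
  have inv: "sum (demand A \<Delta> D f) S \<le> card (nbhd G S - f ` D)"
    if "i \<in> {0, 1}" "S \<subseteq> V i" "card S \<le> m" for i S
    using all that by blast
  have u: "u \<in> D" "(u, w) \<in> A" using step.hyps by auto
  have DW: "D \<subseteq> W" using grown_subset[OF step.hyps(1) \<open>R \<subseteq> W\<close> W(2)] .
  have finD: "finite D" using DW W finite_subset by blast
  have "card (f ` D) \<le> M"
    using card_image_le[OF finD, of f] card_mono[OF W(1) DW] W(3) by linarith
  have V: "V 0 \<union> V 1 = pverts G" "V 0 \<inter> V 1 = {}" "parcs G \<subseteq> V 0 \<times> V 1 \<union> V 1 \<times> V 0"
    using bip by (auto simp: bipartition_def)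
  have finV: "finite (V i)" if "i \<in> {0, 1}" for i
    using that V(1) pair_finite_verts finite_subset[of "V i" "pverts G"] by blast
  \<comment> \<open>At most 2m vertices with demand at most 2\<Delta> each need at most 4\<Delta>m
    neighbours, while at least 8\<Delta>m remain after discarding the at most M used
    vertices.\<close>
  have slack: "sum (demand A \<Delta> D f) S < card (nbhd G S - f ` D)"
    if "i \<in> {0, 1}" "S \<subseteq> V i" "m \<le> card S" "card S \<le> 2 * m" for i S
  proof -
    have "sum (demand A \<Delta> D f) S \<le> card S * (2 * \<Delta>)"
      using sum_bounded_above[of S "demand A \<Delta> D f" "2 * \<Delta>"] demand_le[OF finA deg, of D f] by simp
    also have "\<dots> \<le> (2 * m) * (2 * \<Delta>)" using that by (intro mult_right_mono) auto
    also have "\<dots> < 8 * \<Delta> * m" using \<open>m > 0\<close> \<open>\<Delta> > 0\<close> by simp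
    also have "\<dots> \<le> card (nbhd G S) - card (f ` D)"
      using large[OF that] \<open>card (f ` D) \<le> M\<close> by linarith
    also have "\<dots> \<le> card (nbhd G S - f ` D)" using finD by (intro diff_card_le_card_Diff) auto
    finally show ?thesis .
  qed
  obtain j where j: "j \<in> {0, 1}" "f u \<in> V j" using f(3) u(1) V(1) by blast
  have pos: "demand A \<Delta> D f (f u) > 0" using demand_image[OF f(2) u(1)] \<open>\<Delta> > 0\<close> by simp
  have "\<exists>y\<in>nbhd G {f u} - f ` D. \<forall>S. S \<subseteq> V j \<longrightarrow> card S \<le> m \<longrightarrow> f u \<notin> S \<longrightarrow>
          y \<in> nbhd G S \<longrightarrow> sum (demand A \<Delta> D f) S < card (nbhd G S - f ` D)"
    by (rule exists_slack_neighbour[OF G finV[OF j(1)] \<open>m > 0\<close> inv[OF j(1)] slack[OF j(1)] j(2) pos])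
  then obtain y where y: "y \<in> nbhd G {f u} - f ` D"
    and ys: "\<forall>S. S \<subseteq> V j \<longrightarrow> card S \<le> m \<longrightarrow> f u \<notin> S \<longrightarrow> y \<in> nbhd G S \<longrightarrow>
               sum (demand A \<Delta> D f) S < card (nbhd G S - f ` D)"
    by (elim bexE)
  have uy: "(f u, y) \<in> parcs G" and yD: "y \<notin> f ` D" using y by (auto simp: nbhd_def)
  let ?f = "f(w := y)" and ?D = "insert w D"
  have img: "?f ` ?D = insert y (f ` D)" using step.hyps by auto
  have ext: "demand A \<Delta> ?D ?f z + (if z = f u then 1 else 0) \<le> demand A \<Delta> D f z" for z
    by (rule demand_extend[OF finA deg f(2) step.hyps(2,3) yD])
  have inv': "sum (demand A \<Delta> ?D ?f) S \<le> card (nbhd G S - ?f ` ?D)"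
    if S: "i \<in> {0, 1}" "S \<subseteq> V i" "card S \<le> m" for i S
  proof -
    have finS: "finite S" using S finV finite_subset by blast
    have le: "sum (demand A \<Delta> ?D ?f) S + (if f u \<in> S then 1 else 0) \<le> sum (demand A \<Delta> D f) S"
    proof -
      have "sum (demand A \<Delta> ?D ?f) S + (if f u \<in> S then 1 else 0)
            = (\<Sum>z\<in>S. demand A \<Delta> ?D ?f z + (if z = f u then 1 else 0))"
        using finS by (simp add: sum.distrib)
      also have "\<dots> \<le> sum (demand A \<Delta> D f) S" using ext by (intro sum_mono)
      finally show ?thesis .
    qed
    show ?thesis
    proof (cases "y \<in> nbhd G S")
      case False
      then have "nbhd G S - ?f ` ?D = nbhd G S - f ` D" unfolding img by auto
      then show ?thesis using inv[OF S] le by simp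
    next
      case True
      \<comment> \<open>Both \<open>s\<close> and \<open>f u\<close> are adjacent to
        \<open>y\<close>, hence lie on the same side. Sets on the other side never lose
        \<open>y\<close>, so choosing \<open>y\<close> with regard to \<open>V j\<close> alone
        suffices.\<close>
      then obtain s where "s \<in> S" "(s, y) \<in> parcs G" by (auto simp: nbhd_def)
      then have "(s, y) \<in> V 0 \<times> V 1 \<union> V 1 \<times> V 0" "(f u, y) \<in> V 0 \<times> V 1 \<union> V 1 \<times> V 0" "s \<in> V i"
        using V(3) uy S(2) by blast+
      then have "i = j" using V(2) S(1) j by auto
      have "nbhd G S - f ` D = insert y (nbhd G S - ?f ` ?D)" unfolding img using True yD by auto
      moreover have "y \<notin> nbhd G S - ?f ` ?D" unfolding img by auto
      ultimately have "card (nbhd G S - f ` D) = Suc (card (nbhd G S - ?f ` ?D))"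
        using finite_nbhd[OF G, of S] by simp
      then show ?thesis
        using inv[OF S] le ys[rule_format, of S] S True \<open>i = j\<close> by (cases "f u \<in> S") auto
    qed
  qed
  have arcs: "(?f a, ?f b) \<in> parcs G" if ab: "a \<in> ?D" "b \<in> ?D" "(a, b) \<in> A" for a b
  proof -
    have nbr: "d = u" if "d \<in> D" "(d, w) \<in> A" for d using step.hyps(3) that by blast
    consider "a \<in> D" "b \<in> D" | "a = w" "b \<in> D" | "a \<in> D" "b = w" | "a = w" "b = w"
      using ab(1,2) by blast
    then show ?thesis
    proof cases
      case 1
      then have "a \<noteq> w" "b \<noteq> w" using step.hyps(2) by blast+
      then show ?thesis using f(4) 1 ab(3) by simp
    next
      case 2
      then have "b = u" "b \<noteq> w" using nbr[OF 2(2)] symD[OF sym ab(3)] step.hyps(2) by auto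
      then show ?thesis using 2 symG[OF uy] by simp
    next
      case 3
      then have "a = u" "a \<noteq> w" using nbr[OF 3(1)] ab(3) step.hyps(2) by auto
      then show ?thesis using 3 uy by simp
    next
      case 4
      then show ?thesis using irr ab(3) by (simp add: irrefl_def)
    qed
  qed
  have "?f v = f0 v" if "v \<in> R" for v
    using that f(1) grown_superset[OF step.hyps(1)] step.hyps(2) by auto
  moreover have "inj_on ?f ?D" using f(2) yD step.hyps(2) by (auto simp: inj_on_def)
  moreover have "?f ` ?D \<subseteq> pverts G" unfolding img using f(3) in_arcsD2[OF uy] by blast
  ultimately show ?case using arcs inv' by (intro exI[of _ ?f]) blast
qed

section \<open>Every rooted tree can be grown from its root\<close>

lemma pcas_snoc: "pcas a (p @ [(b, c)]) d \<longleftrightarrow> pcas a p b \<and> c = d"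
  by (induction p arbitrary: a) auto

lemma pawalk_verts_snoc: "pcas a p b \<Longrightarrow> pawalk_verts a (p @ [(b, c)]) = pawalk_verts a p @ [c]"
  by (induction p arbitrary: a) auto

text \<open>Confinement to \<open>D\<close> allows a path to be prolonged by a vertex outside
  \<open>D\<close> without repeating a vertex.\<close>

definition path_in :: "('a \<times> 'a) set \<Rightarrow> 'a set \<Rightarrow> 'a \<Rightarrow> ('a \<times> 'a) list \<Rightarrow> 'a \<Rightarrow> bool" where
  "path_in A D a p b \<longleftrightarrow> set p \<subseteq> A \<and> pcas a p b \<and> distinct (pawalk_verts a p) \<and> set (pawalk_verts a p) \<subseteq> D"

text \<open>A new vertex reaches the others through its attachment vertex. These paths later close
  the cycle that contradicts acyclicity.\<close>

lemma grown_path: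
  assumes "sym A" "grown A {r} D" "a \<in> D" "b \<in> D"
  shows "\<exists>p. path_in A D a p b"
  using assms(2-)
proof (induction arbitrary: a b rule: grown.induct)
  case base
  then show ?case by (intro exI[of _ "[]"]) (auto simp: path_in_def)
next
  case (step D w u)
  have u: "u \<in> D" "(u, w) \<in> A" "(w, u) \<in> A" using step.hyps symD[OF assms(1)] by blast+
  consider "a = w" "b = w" | "a = w" "b \<in> D" | "a \<in> D" "b = w" | "a \<in> D" "b \<in> D"
    using step.prems by blast
  then show ?case
  proof cases
    case 1
    then show ?thesis by (intro exI[of _ "[]"]) (auto simp: path_in_def)
  next
    case 2
    obtain p where "path_in A D u p b" using step.IH[OF u(1) 2(2)] by blast
    then show ?thesis using 2 u step.hyps(2)
      by (intro exI[of _ "(w, u) # p"]) (auto simp: path_in_def)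
  next
    case 3
    obtain p where "path_in A D a p u" using step.IH[OF 3(1) u(1)] by blast
    then show ?thesis using 3 u step.hyps(2)
      by (intro exI[of _ "p @ [(u, w)]"]) (auto simp: path_in_def pcas_snoc pawalk_verts_snoc)
  next
    case 4
    obtain p where "path_in A D a p b" using step.IH[OF 4] by blast
    then show ?thesis by (intro exI[of _ p]) (auto simp: path_in_def)
  qed
qed

text \<open>Take a maximal grown set \<open>D\<close>. An outside vertex with two neighbours in
  \<open>D\<close> would close a cycle, and one with a single neighbour would extend
  \<open>D\<close>. So no arc leaves \<open>D\<close>, and connectedness makes it
  everything.\<close>

lemma rooted_tree_grown:
  assumes "rooted_tree T r"
  shows "grown (parcs T) {r} (pverts T)"
proof -
  have T: "pair_graph T" "connected (with_proj T)" "r \<in> pverts T"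
    and acyc: "\<And>p. pre_digraph.cycle (with_proj T) p \<Longrightarrow> length p < 3"
    using assms by (auto simp: rooted_tree_def graph_tree_def not_le)
  interpret pair_graph T by fact
  have sym: "sym (parcs T)" using pair_sym_arcs by (simp add: symmetric_def)
  have sub: "D \<subseteq> pverts T" if "grown (parcs T) {r} D" for D
    by (rule grown_subset[OF that]) (use T(3) in_arcsD1 in_arcsD2 in auto)
  have "{D. grown (parcs T) {r} D} \<subseteq> Pow (pverts T)" using sub by blast
  then have "finite {D. grown (parcs T) {r} D}"
    by (rule finite_subset) (simp add: pair_finite_verts)
  moreover have "{r} \<in> {D. grown (parcs T) {r} D}" by (auto intro: grown.base)
  ultimately obtain D where D: "grown (parcs T) {r} D"
    and max: "\<And>E. grown (parcs T) {r} E \<Longrightarrow> D \<subseteq> E \<Longrightarrow> E = D"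
    using finite_has_maximal[of "{D. grown (parcs T) {r} D}"] by blast
  have rD: "r \<in> D" using grown_superset[OF D] by simp
  have closed: "w \<in> D" if u: "u \<in> D" and uw: "(u, w) \<in> parcs T" for u w
  proof (rule ccontr)
    assume w: "w \<notin> D"
    have "{v \<in> D. (v, w) \<in> parcs T} = {u}"
    proof (rule ccontr)
      assume "{v \<in> D. (v, w) \<in> parcs T} \<noteq> {u}"
      then obtain v where v: "v \<in> D" "(v, w) \<in> parcs T" "v \<noteq> u" using u uw by blast
      obtain p where p: "path_in (parcs T) D u p v" using grown_path[OF sym D u v(1)] by blast
      \<comment> \<open>As \<open>u\<close> and \<open>v\<close> differ, \<open>p\<close> is
        nonempty. The cycle thus has length at least three and is not a mere edge traversed back and
        forth.\<close>
      let ?c = "(w, u) # p @ [(v, w)]"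
      have "last (pawalk_verts u p) = v" using p awlast_if_cas by (simp add: path_in_def)
      then have "awalk w ?c w"
        using p v(2) symD[OF sym uw] in_arcsD2[OF uw] by (auto simp: awalk_def path_in_def pcas_snoc)
      moreover have "distinct (tl (pawalk_verts w ?c))"
        using p w by (auto simp: path_in_def pawalk_verts_snoc)
      ultimately have "cycle ?c" unfolding cycle_def by blast
      moreover have "p \<noteq> []" using p v(3) by (auto simp: path_in_def)
      then have "length ?c \<ge> 3" by (cases p) auto
      ultimately show False using acyc[of ?c] by simp
    qed
    then have "grown (parcs T) {r} (insert w D)" using grown.step[OF D w] by blast
    then show False using max[of "insert w D"] w by blast
  qed
  have "z \<in> D" if z: "z \<in> pverts T" for z
  proof -
    \<comment> \<open>Symmetry of the arcs turns connectedness into reachability from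
      \<open>r\<close> along arcs.\<close>
    have "strongly_connected (with_proj T)"
      using symmetric_connected_imp_strongly_connected[OF pair_sym_arcs T(2)] .
    then have "r \<rightarrow>\<^sup>*\<^bsub>with_proj T\<^esub> z" using T(3) z by (auto simp: strongly_connected_def)
    then show ?thesis
    proof (induction rule: reachable_induct)
      case base then show ?case using rD by simp
    next
      case (step a b) then show ?case using closed by simp
    qed
  qed
  then have "D = pverts T" using sub[OF D] by blast
  then show ?thesis using D by simp
qed

section \<open>The disjoint union of the trees\<close>

text \<open>Tagging vertices with the index separates trees that share vertices, so a single
  injective map on the union yields disjoint copies.\<close>

definition forest_arcs :: "'i set \<Rightarrow> ('i \<Rightarrow> ('b \<times> 'b) set) \<Rightarrow> (('i \<times> 'b) \<times> ('i \<times> 'b)) set" where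
  "forest_arcs I B = {((i, u), (i, v)) | i u v. i \<in> I \<and> (u, v) \<in> B i}"

lemma forest_arcs_iff [simp]:
  "((i, u), (j, v)) \<in> forest_arcs I B \<longleftrightarrow> i = j \<and> i \<in> I \<and> (u, v) \<in> B i"
  by (auto simp: forest_arcs_def)

lemma forest_arcs_nbrs:
  "{w. ((i, u), w) \<in> forest_arcs I B} = (if i \<in> I then Pair i ` {v. (u, v) \<in> B i} else {})"
  by (auto simp: forest_arcs_def)

text \<open>No arc joins different indices, so the growth of tree \<open>i\<close> can be replayed
  on top of \<open>D\<close>. The slice condition says that so far only its root is present.\<close>

lemma grown_forest_component:
  assumes D: "grown (forest_arcs I B) R D" and i: "i \<in> I" and slice: "D \<inter> {i} \<times> UNIV = {(i, r)}"
    and "grown (B i) {r} E"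
  shows "grown (forest_arcs I B) R (D \<union> {i} \<times> E)"
  using assms(4)
proof (induction rule: grown.induct)
  case base
  have "D \<union> {i} \<times> {r} = D" using slice by blast
  then show ?case using D by simp
next
  case (step E w u)
  have "r \<in> E" using grown_superset[OF step.hyps(1)] by simp
  have slice': "(i, v) \<in> D \<union> {i} \<times> E \<longleftrightarrow> v \<in> E" for v
    using eqset_imp_iff[OF slice, of "(i, v)"] \<open>r \<in> E\<close> by auto
  have "{v \<in> D \<union> {i} \<times> E. (v, (i, w)) \<in> forest_arcs I B} = Pair i ` {v \<in> E. (v, w) \<in> B i}"
    using slice' i by (auto simp: forest_arcs_def)
  then have "grown (forest_arcs I B) R (insert (i, w) (D \<union> {i} \<times> E))"
    using step.hyps slice'[of w] by (intro grown.step[OF step.IH, of _ "(i, u)"]) auto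
  then show ?case by (simp add: insert_Times_insert Un_insert_right)
qed

lemma grown_forest:
  assumes "finite I" and grown: "\<And>i. i \<in> I \<Longrightarrow> grown (B i) {r i} (W i)"
  shows "grown (forest_arcs I B) ((\<lambda>i. (i, r i)) ` I) (Sigma I W)"
proof -
  let ?R = "(\<lambda>i. (i, r i)) ` I"
  \<comment> \<open>All roots are present from the outset, including those of trees not yet grown,
    because their images are prescribed.\<close>
  have "grown (forest_arcs I B) ?R (?R \<union> Sigma J W)" if "finite J" "J \<subseteq> I" for J
    using that
  proof (induction J rule: finite_induct)
    case empty then show ?case by (simp add: grown.base)
  next
    case (insert i J)
    have "grown (forest_arcs I B) ?R ((?R \<union> Sigma J W) \<union> {i} \<times> W i)"
      using insert by (intro grown_forest_component[where r = "r i"] grown) auto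
    moreover have "(?R \<union> Sigma J W) \<union> {i} \<times> W i = ?R \<union> Sigma (insert i J) W" by auto
    ultimately show ?case by simp
  qed
  then have "grown (forest_arcs I B) ?R (?R \<union> Sigma I W)" using \<open>finite I\<close> by blast
  moreover have "r i \<in> W i" if "i \<in> I" for i using grown_superset[OF grown[OF that]] by simp
  then have "?R \<union> Sigma I W = Sigma I W" by auto
  ultimately show ?thesis by simp
qed

section \<open>Degrees, and assembly of the theorem\<close>

lemma out_degree_eq_card: "out_degree (with_proj T) u = card {v. (u, v) \<in> parcs T}"
proof -
  have "out_arcs (with_proj T) u = Pair u ` {v. (u, v) \<in> parcs T}" by (auto simp: out_arcs_def)
  then show ?thesis by (simp add: out_degree_def card_image inj_on_def)
qed

lemma out_degree_le_max_degree:
  assumes "pair_graph T"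
  shows "out_degree (with_proj T) u \<le> max_degree T"
proof -
  interpret pair_graph T by fact
  show ?thesis
  proof (cases "u \<in> pverts T")
    case True then show ?thesis unfolding max_degree_def using pair_finite_verts by (intro Max_ge) auto
  next
    case False
    then have "{v. (u, v) \<in> parcs T} = {}" using in_arcsD1 by blast
    then show ?thesis by (simp add: out_degree_eq_card)
  qed
qed

theorem theorem2p5:
  fixes \<Delta> M t m :: nat
    and G :: "'a pair_pre_digraph" and V :: "nat \<Rightarrow> 'a set"
    and x :: "nat \<Rightarrow> 'a" and X :: "'a set"
    and T :: "'a \<Rightarrow> 'b pair_pre_digraph" and root :: "'a \<Rightarrow> 'b"
  assumes "\<Delta> > 0" and "M > 0" and "t > 0" and "m > 0"
    and "pair_graph G" and "bipartition G (V 0) (V 1)"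
    and "inj_on x {1..t}" and "X = x ` {1..t}" and "X \<subseteq> V 0 \<union> V 1"
    and "\<forall>i\<in>{1..t}. rooted_tree (T (x i)) (root (x i))"
    and "(\<Sum>i=1..t. card (pverts (T (x i)))) \<le> M"
    and "\<forall>i\<in>{1..t}. max_degree (T (x i)) \<le> \<Delta>"
    and "\<forall>i\<in>{0,1}. \<forall>S. S \<subseteq> V i \<and> card S \<le> m \<longrightarrow>
           card (nbhd G S - X) \<ge> 2 * \<Delta> * card (S - X)
             + (\<Sum>v\<in>S \<inter> X. out_degree (with_proj (T v)) (root v) + \<Delta>)"
    and "\<forall>i\<in>{0,1}. \<forall>S. S \<subseteq> V i \<and> m \<le> card S \<and> card S \<le> 2 * m \<longrightarrow>
           card (nbhd G S) \<ge> M + 8 * \<Delta> * m"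
  shows "\<exists>\<phi> :: nat \<Rightarrow> 'b \<Rightarrow> 'a.
           (\<forall>i\<in>{1..t}. graph_embedding (\<phi> i) (T (x i)) G \<and> \<phi> i (root (x i)) = x i) \<and>
           (\<forall>i\<in>{1..t}. \<forall>j\<in>{1..t}. i \<noteq> j \<longrightarrow>
              \<phi> i ` pverts (T (x i)) \<inter> \<phi> j ` pverts (T (x j)) = {})"
proof -
  let ?I = "{1..t}" and ?B = "\<lambda>i. parcs (T (x i))" and ?r = "\<lambda>i. root (x i)"
  let ?W = "Sigma ?I (\<lambda>i. pverts (T (x i)))" and ?A = "forest_arcs ?I ?B"
  \<comment> \<open>On \<open>?R\<close> the map \<open>?f0\<close> places each root at its
    prescribed vertex, so the index alone determines the value.\<close>
  let ?R = "(\<lambda>i. (i, ?r i)) ` ?I" and ?f0 = "\<lambda>(i, b). x i"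
  note X = \<open>X = x ` {1..t}\<close>
  have tree: "rooted_tree (T (x i)) (?r i)" if "i \<in> ?I" for i using assms(10) that by blast
  have pg: "pair_graph (T (x i))" and rt: "?r i \<in> pverts (T (x i))" if "i \<in> ?I" for i
    using tree[OF that] by (auto simp: rooted_tree_def graph_tree_def)
  have fin: "finite (pverts (T (x i)))" if "i \<in> ?I" for i
    using pair_fin_digraph.pair_finite_verts pg[OF that] by (auto simp: pair_graph_def pair_digraph_def)
  have symT: "(v, u) \<in> ?B i" if "i \<in> ?I" "(u, v) \<in> ?B i" for i u v
  proof -
    interpret pair_graph "T (x i)" by (rule pg[OF that(1)])
    show ?thesis using symD[OF pair_sym_arcs[unfolded symmetric_def]] that(2) by simp
  qed
  have arcT: "u \<in> pverts (T (x i))" "v \<in> pverts (T (x i))" "u \<noteq> v" if "i \<in> ?I" "(u, v) \<in> ?B i" for i u v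
  proof -
    interpret pair_graph "T (x i)" by (rule pg[OF that(1)])
    show "u \<in> pverts (T (x i))" "v \<in> pverts (T (x i))" "u \<noteq> v"
      using in_arcsD1 in_arcsD2 pair_no_loops that(2) by fastforce+
  qed
  have V: "V 0 \<union> V 1 = pverts G" using assms(6) by (auto simp: bipartition_def)
  have finW: "finite ?W" using fin by auto
  have AW: "?A \<subseteq> ?W \<times> ?W" using arcT by (auto simp: forest_arcs_def)
  have cW: "card ?W \<le> M" using assms(11) fin by (subst card_SigmaI) auto
  have RW: "?R \<subseteq> ?W" using rt by auto
  have symA: "sym ?A" using symT by (auto simp: forest_arcs_def intro!: symI)
  have irr: "irrefl ?A" using arcT(3) by (auto simp: forest_arcs_def irrefl_def)
  have deg: "card {w. (u, w) \<in> ?A} \<le> \<Delta>" for u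
  proof (cases u)
    case (Pair i b)
    have "card {v. (b, v) \<in> ?B i} \<le> \<Delta>" if "i \<in> ?I"
      using out_degree_le_max_degree[OF pg[OF that], of b] assms(12) that
      by (auto simp: out_degree_eq_card intro: order_trans)
    then show ?thesis unfolding Pair forest_arcs_nbrs by (auto simp: card_image inj_on_def)
  qed
  have injR: "inj_on ?f0 ?R" by (rule inj_onI) (use inj_onD[OF assms(7)] in force)
  have imgR: "?f0 ` ?R = X" using X by (auto simp: image_image)
  have indep: "?A \<inter> ?R \<times> ?R = {}" using arcT(3) by (auto simp: forest_arcs_def)
  \<comment> \<open>Initially only roots are placed and no tree has a loop, so every neighbour of a
    root is still pending.\<close>
  have dem: "demand ?A \<Delta> ?R ?f0 v = out_degree (with_proj (T v)) (root v) + \<Delta>" if "v \<in> X" for v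
  proof -
    obtain i where i: "i \<in> ?I" "v = x i" using \<open>v \<in> X\<close> X by blast
    have "demand ?A \<Delta> ?R ?f0 (?f0 (i, ?r i)) = card {w. ((i, ?r i), w) \<in> ?A \<and> w \<notin> ?R} + \<Delta>"
      by (rule demand_image[OF injR]) (use i in auto)
    moreover have "{w. ((i, ?r i), w) \<in> ?A \<and> w \<notin> ?R} = Pair i ` {v. (?r i, v) \<in> ?B i}"
      using i(1) arcT(3)[OF i(1)] by (auto simp: forest_arcs_def)
    ultimately show ?thesis using i by (simp add: out_degree_eq_card card_image inj_on_def)
  qed
  \<comment> \<open>Splitting \<open>S\<close> along \<open>X\<close> turns the first expansion
    hypothesis into the invariant for the initial placement.\<close>
  have small: "sum (demand ?A \<Delta> ?R ?f0) S \<le> card (nbhd G S - ?f0 ` ?R)"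
    if "i \<in> {0, 1}" "S \<subseteq> V i" "card S \<le> m" for i S
  proof -
    interpret pair_graph G by fact
    have "S \<subseteq> pverts G" using that V by auto
    then have "finite S" using pair_finite_verts finite_subset by blast
    then have "sum (demand ?A \<Delta> ?R ?f0) S = sum (demand ?A \<Delta> ?R ?f0) (S - X) + sum (demand ?A \<Delta> ?R ?f0) (S \<inter> X)"
      by (subst sum.Int_Diff[of S _ X]) simp_all
    also have "sum (demand ?A \<Delta> ?R ?f0) (S - X) = (\<Sum>v\<in>S - X. 2 * \<Delta>)"
      by (intro sum.cong refl demand_not_image) (unfold imgR, simp)
    also have "sum (demand ?A \<Delta> ?R ?f0) (S \<inter> X) = (\<Sum>v\<in>S \<inter> X. out_degree (with_proj (T v)) (root v) + \<Delta>)"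
      by (intro sum.cong refl dem) simp
    finally show ?thesis
      using assms(13)[rule_format, OF that(1) conjI[OF that(2,3)]] unfolding imgR by (simp add: mult.commute)
  qed
  have imgR': "?f0 ` ?R \<subseteq> pverts G" unfolding imgR using V assms(9) by simp
  have large: "M + 8 * \<Delta> * m \<le> card (nbhd G S)"
    if "i \<in> {0, 1}" "S \<subseteq> V i" "m \<le> card S" "card S \<le> 2 * m" for i S
    using assms(14) that by blast
  have "grown ?A ?R ?W" by (intro grown_forest rooted_tree_grown tree) auto
  then have "\<exists>f. (\<forall>v\<in>?R. f v = ?f0 v) \<and> inj_on f ?W \<and> f ` ?W \<subseteq> pverts G \<and>
      (\<forall>u v. u \<in> ?W \<longrightarrow> v \<in> ?W \<longrightarrow> (u, v) \<in> ?A \<longrightarrow> (f u, f v) \<in> parcs G) \<and>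
      (\<forall>i\<in>{0, 1}. \<forall>S. S \<subseteq> V i \<longrightarrow> card S \<le> m \<longrightarrow>
         sum (demand ?A \<Delta> ?W f) S \<le> card (nbhd G S - f ` ?W))"
    by (rule grown_embeds[OF assms(5,6,4,1) finW AW cW RW symA irr deg injR imgR' indep small large, rotated -1])
  then obtain f where f: "\<forall>v\<in>?R. f v = ?f0 v" "inj_on f ?W" "f ` ?W \<subseteq> pverts G"
    "\<forall>u v. u \<in> ?W \<longrightarrow> v \<in> ?W \<longrightarrow> (u, v) \<in> ?A \<longrightarrow> (f u, f v) \<in> parcs G"
    by (elim exE conjE)
  show ?thesis
  \<comment> \<open>Injectivity of \<open>f\<close> on the tagged union gives both the injectivity
    of each copy and the disjointness of different copies.\<close>
  proof (intro exI[of _ "\<lambda>i b. f (i, b)"] conjI ballI impI)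
    fix i assume i: "i \<in> ?I"
    show "f (i, ?r i) = x i" using f(1) i by auto
    show "graph_embedding (\<lambda>b. f (i, b)) (T (x i)) G"
      unfolding graph_embedding_def
    proof (intro conjI allI impI)
      show "inj_on (\<lambda>b. f (i, b)) (pverts (T (x i)))"
        using f(2) i by (auto simp: inj_on_def)
      show "(\<lambda>b. f (i, b)) ` pverts (T (x i)) \<subseteq> pverts G" using f(3) i by auto
      show "(f (i, u), f (i, v)) \<in> parcs G" if "(u, v) \<in> parcs (T (x i))" for u v
        using f(4)[rule_format, of "(i, u)" "(i, v)"] arcT[OF i that] i that by simp
    qed
    fix j assume "j \<in> ?I" "i \<noteq> j"
    then show "(\<lambda>b. f (i, b)) ` pverts (T (x i)) \<inter> (\<lambda>b. f (j, b)) ` pverts (T (x j)) = {}"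
      using f(2) i by (auto simp: inj_on_def)
  qed
qed

end
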